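(* Let $X$ and $Y$ be nonempty separable metric spaces and let $c\colon X\times Y\to\mathbb{R}\cup\{+\infty\}$ be a cost whose domain $D$ is nonempty and open in $X\times Y$ and such that $c|_D$ is continuous. Let $G$ be a nonempty subset of $D$. Then the following are equivalent: (a) $G$ has an upper semicontinuous $c$-potential; (b) $G$ has a continuous $c$-antiderivative; (c) $G$ is $c$-path bounded.
   Context: $D:=\{(x,y)\in X\times Y: c(x,y)<+\infty\}$. $X\times Y$ carries the metric $d((x,y),(u,v))=\sqrt{d_X(x,u)^2+d_Y(y,v)^2}$. Conventions: $r-(+\infty)=-\infty$ for $r\in\mathbb{R}$, $\sup\varnothing=-\infty$, $\inf\varnothing=+\infty$. $c$-conjugates: for $\psi\colon X\to[-\infty,+\infty]$, $\psi^c(y):=\inf\{c(x,y)-\psi(x): x\in X,\ (x,y)\in D\}$ for $y\in Y$; for $\varphi\colon Y\to[-\infty,+\infty]$, $\varphi^{\overline c}(x):=\inf\{c(x,y)-\varphi(y): y\in Y,\ (x,y)\in D\}$ for $x\in X$. A function $\psi\colon X\to[-\infty,+\infty]$ is a $c$-class function if $\psi=\varphi^{\overline c}$ for some $\varphi\colon Y\to[-\infty,+\infty]$. $c$-subdifferential: if $\psi(x)\in\mathbb{R}$, $\partial_c\psi(x):=\{y\in Y:\psi(x)+\psi^c(y)=c(x,y)<+\infty\}$; its graph is the set of all $(x,y)\in X\times Y$ with $\psi(x)\in\mathbb{R}$ and $y\in\partial_c\psi(x)$. A $c$-potential of $G$ is a $c$-class function $\psi\colon X\to[-\infty,+\infty]$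 such that $G$ is contained in the graph of $\partial_c\psi$. A $c$-antiderivative of $G$ is a function $f\colon G\to\mathbb{R}$ with $c(x,y)-c(u,y)\le f(x,y)-f(u,v)$ for all $(x,y),(u,v)\in G$. Path: for $(x_s,y_s),(x_e,y_e)\in G$, a path in $G$ from $(x_s,y_s)$ to $(x_e,y_e)$ is a finite sequence $((x_k,y_k))_{k=1}^{N+1}$ in $G$ ($N\ge1$) with $(x_1,y_1)=(x_s,y_s)$, $(x_{N+1},y_{N+1})=(x_e,y_e)$ and $c(x_{k+1},y_k)<+\infty$ for every $k\in\{1,\dots,N\}$. Maximal inner variation: $F_G\big((x_s,y_s),(x_e,y_e)\big):=\sup\sum_{k=1}^N\big(c(x_k,y_k)-c(x_{k+1},y_k)\big)$ over all such paths. $G$ is $c$-path bounded if $F_G<+\infty$ on $G\times G$. *)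

theory Defs
  imports "HOL-Analysis.Analysis"
begin

(* A cost X x Y -> R \<union> {+infinity} is an ereal-valued function on pairs; that it omits the value
   -infinity is a separate hypothesis. Under that hypothesis and for G contained in
   cost_dom c, every ereal difference below has a finite minuend, so ereal subtraction gives r - (+infinity) = -infinity and
   r - (-infinity) = +infinity, and Sup {} = -infinity, Inf {} = +infinity hold in ereal. *)

definition cost_dom :: "('a \<times> 'b \<Rightarrow> ereal) \<Rightarrow> ('a \<times> 'b) set" where
  "cost_dom c = {p. c p < \<infinity>}"

definition c_conj :: "('a \<times> 'b \<Rightarrow> ereal) \<Rightarrow> ('a \<Rightarrow> ereal) \<Rightarrow> 'b \<Rightarrow> ereal" where
  "c_conj c \<psi> y = Inf {c (x, y) - \<psi> x | x. (x, y) \<in> cost_dom c}"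

definition cbar_conj :: "('a \<times> 'b \<Rightarrow> ereal) \<Rightarrow> ('b \<Rightarrow> ereal) \<Rightarrow> 'a \<Rightarrow> ereal" where
  "cbar_conj c \<phi> x = Inf {c (x, y) - \<phi> y | y. (x, y) \<in> cost_dom c}"

definition c_class :: "('a \<times> 'b \<Rightarrow> ereal) \<Rightarrow> ('a \<Rightarrow> ereal) \<Rightarrow> bool" where
  "c_class c \<psi> \<longleftrightarrow> (\<exists>\<phi>. \<psi> = cbar_conj c \<phi>)"

(* Meaningful only at points where \<psi> x is real; the graph imposes this condition. *)
definition c_subdiff :: "('a \<times> 'b \<Rightarrow> ereal) \<Rightarrow> ('a \<Rightarrow> ereal) \<Rightarrow> 'a \<Rightarrow> 'b set" where
  "c_subdiff c \<psi> x = {y. \<psi> x + c_conj c \<psi> y = c (x, y) \<and> c (x, y) < \<infinity>}"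

definition c_subdiff_graph :: "('a \<times> 'b \<Rightarrow> ereal) \<Rightarrow> ('a \<Rightarrow> ereal) \<Rightarrow> ('a \<times> 'b) set" where
  "c_subdiff_graph c \<psi> = {(x, y). \<bar>\<psi> x\<bar> \<noteq> \<infinity> \<and> y \<in> c_subdiff c \<psi> x}"

definition c_potential ::
  "('a \<times> 'b \<Rightarrow> ereal) \<Rightarrow> ('a \<times> 'b) set \<Rightarrow> ('a \<Rightarrow> ereal) \<Rightarrow> bool" where
  "c_potential c G \<psi> \<longleftrightarrow> c_class c \<psi> \<and> G \<subseteq> c_subdiff_graph c \<psi>"

(* Only the values of f on G matter. *)
definition c_antiderivative ::
  "('a \<times> 'b \<Rightarrow> ereal) \<Rightarrow> ('a \<times> 'b) set \<Rightarrow> ('a \<times> 'b \<Rightarrow> real) \<Rightarrow> bool" where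
  "c_antiderivative c G f \<longleftrightarrow>
     (\<forall>x y u v. (x, y) \<in> G \<longrightarrow> (u, v) \<in> G \<longrightarrow>
        c (x, y) - c (u, y) \<le> ereal (f (x, y) - f (u, v)))"

(* The path p 1, ..., p (N + 1); values of p at other indices are irrelevant. *)
definition c_path ::
  "('a \<times> 'b \<Rightarrow> ereal) \<Rightarrow> ('a \<times> 'b) set \<Rightarrow> 'a \<times> 'b \<Rightarrow> 'a \<times> 'b \<Rightarrow>
     nat \<Rightarrow> (nat \<Rightarrow> 'a \<times> 'b) \<Rightarrow> bool" where
  "c_path c G s e N p \<longleftrightarrow>
     1 \<le> N \<and> (\<forall>k\<in>{1..N + 1}. p k \<in> G) \<and> p 1 = s \<and> p (N + 1) = e \<and>
     (\<forall>k\<in>{1..N}. c (fst (p (k + 1)), snd (p k)) < \<infinity>)"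

definition max_inner_variation ::
  "('a \<times> 'b \<Rightarrow> ereal) \<Rightarrow> ('a \<times> 'b) set \<Rightarrow> 'a \<times> 'b \<Rightarrow> 'a \<times> 'b \<Rightarrow> ereal" where
  "max_inner_variation c G s e =
     Sup {\<Sum>k=1..N. c (p k) - c (fst (p (k + 1)), snd (p k)) | N p. c_path c G s e N p}"

definition c_path_bounded :: "('a \<times> 'b \<Rightarrow> ereal) \<Rightarrow> ('a \<times> 'b) set \<Rightarrow> bool" where
  "c_path_bounded c G \<longleftrightarrow> (\<forall>s\<in>G. \<forall>e\<in>G. max_inner_variation c G s e < \<infinity>)"

definition upper_semicontinuous :: "('a::topological_space \<Rightarrow> ereal) \<Rightarrow> bool" where
  "upper_semicontinuous \<psi> \<longleftrightarrow> (\<forall>a. open {x. \<psi> x < a})"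

end

theory Submission
  imports Defs
begin

text \<open>
  Write \<open>F\<close> for the maximal inner variation of \<open>G\<close>. Concatenating paths shows
  \<open>F s r + F r t \<le> F s t\<close>, and one-step paths show that \<open>F s t\<close> dominates
  \<open>c (x, y) - c (u, y)\<close> for \<open>s = (x, y)\<close>, \<open>t = (u, v)\<close>. Telescoping along a path shows that
  a real function \<open>f\<close> on \<open>G\<close> is an antiderivative exactly when \<open>F s t \<le> f s - f t\<close> for all
  \<open>s\<close>, \<open>t\<close> in \<open>G\<close>, that is, when \<open>f\<close> is a feasible potential for the kernel \<open>F\<close>. So an
  antiderivative forces \<open>F < \<infinity>\<close>, and the substance of the theorem is the converse.

  When any two points of \<open>G\<close> are joined by a path, \<open>f s = F s e\<close> for a fixed \<open>e\<close> would do
  (Rockafellar's formula). In general \<open>F s e\<close> may be \<open>-\<infinity>\<close>, and no single base point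
  suffices. Since the domain of \<open>c\<close> is open, however, points of \<open>G\<close> that are close enough are
  joined in both directions by one-step paths, so by separability every point of \<open>G\<close> is linked
  both ways to some point of a countable set \<open>E \<subseteq> G\<close>. On \<open>E\<close> a feasible potential \<open>g\<close> is
  chosen one value at a time: finitely many earlier values impose finitely many bounds on the
  next one, and these are compatible by superadditivity. It extends to \<open>G\<close> by the
  McShane-type formula \<open>f s = (SUP e\<in>E. F s e + g e)\<close>, whose values are finite thanks to the
  links.

  The two regularity requirements are automatic. The antiderivative inequality, used in both
  directions between \<open>s\<close> and a nearby \<open>t\<close>, squeezes \<open>f t - f s\<close> between differences of cost
  values that tend to \<open>0\<close>; and a \<open>c\<close>-class function is an infimum of functions whose strict
  sublevel sets are open. Potentials and antiderivatives determine each other on \<open>G\<close> through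
  \<open>f (x, y) = \<psi> x\<close>: an antiderivative \<open>f\<close> depends on \<open>x\<close> only and \<open>c - f\<close> on \<open>y\<close> only,
  and the conjugate of \<open>y \<mapsto> c (x, y) - f (x, y)\<close> is the potential.
\<close>

section \<open>Feasible potentials for superadditive kernels\<close>

text \<open>
  The upper bounds on the suprema exclude the sum of \<open>\<infinity>\<close> and \<open>-\<infinity>\<close>, which is \<open>\<infinity>\<close> in
  \<^typ>\<open>ereal\<close>; an empty set together with a set that is unbounded above would violate the
  conclusion.
\<close>

lemma ereal_Sup_add_le:
  fixes A B :: "ereal set"
  assumes le: "\<And>a b. a \<in> A \<Longrightarrow> b \<in> B \<Longrightarrow> a + b \<le> C"
    and A: "Sup A < \<infinity>" and B: "Sup B < \<infinity>"
  shows "Sup A + Sup B \<le> C"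
proof (cases "Sup A = -\<infinity> \<or> Sup B = -\<infinity>")
  case True
  then show ?thesis using A B by (cases "Sup A"; cases "Sup B") auto
next
  case False
  then have ne: "A \<noteq> {}" "B \<noteq> {}"
    by (auto simp: bot_ereal_def)
  have 1: "a + Sup B \<le> C" if a: "a \<in> A" for a
  proof (cases "a = -\<infinity>")
    case True
    then show ?thesis using B by (cases "Sup B") auto
  next
    case False
    have "a + Sup B = (SUP b\<in>B. a + b)"
      using SUP_ereal_add_right[OF ne(2) False, of "\<lambda>b. b"] by simp
    also have "\<dots> \<le> C"
      using le a by (intro SUP_least) auto
    finally show ?thesis .
  qed
  have "Sup A + Sup B = (SUP a\<in>A. a + Sup B)"
    using SUP_ereal_add_left[OF ne(1), of "Sup B" "\<lambda>a. a"] False by simp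
  also have "\<dots> \<le> C"
    using 1 by (intro SUP_least) auto
  finally show ?thesis .
qed

lemma real_between_finite_ereal_sets:
  fixes A B :: "ereal set"
  assumes fin: "finite A" "finite B"
    and A: "\<And>a. a \<in> A \<Longrightarrow> a < \<infinity>" and B: "\<And>b. b \<in> B \<Longrightarrow> -\<infinity> < b"
    and le: "\<And>a b. a \<in> A \<Longrightarrow> b \<in> B \<Longrightarrow> a \<le> b"
  shows "\<exists>r::real. (\<forall>a\<in>A. a \<le> ereal r) \<and> (\<forall>b\<in>B. ereal r \<le> b)"
proof -
  define L where "L = Max (insert (-\<infinity>) A)"
  define U where "U = Min (insert \<infinity> B)"
  have L: "a \<le> L" if "a \<in> A" for a
    using that fin by (simp add: L_def)
  have U: "U \<le> b" if "b \<in> B" for b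
    using that fin by (simp add: U_def)
  have Lin: "L \<in> insert (-\<infinity>) A"
    unfolding L_def by (rule Max_in) (use fin in auto)
  have Uin: "U \<in> insert \<infinity> B"
    unfolding U_def by (rule Min_in) (use fin in auto)
  have LU: "L \<le> U" "L < \<infinity>" "-\<infinity> < U"
    using Lin Uin A B le by auto
  have "\<exists>r::real. L \<le> ereal r \<and> ereal r \<le> U"
    using LU by (cases L; cases U) auto
  then show ?thesis
    using L U by (meson order_trans)
qed

text \<open>
  The value \<open>g n\<close> is chosen after \<open>g 0, \<dots>, g (n - 1)\<close>. It has to lie above all
  \<open>F n i + g i\<close> and below all \<open>g j - F j n\<close> with \<open>i, j < n\<close>. Each lower bound is at most each
  upper bound because \<open>F j n + F n i \<le> F j i \<le> g j - g i\<close>. As there are only finitely many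
  bounds, no lower one equal to \<open>\<infinity>\<close> and no upper one equal to \<open>-\<infinity>\<close>, a real number fits in
  between; infinitely many lower bounds could be unbounded.
\<close>

lemma feasible_potential_nat:
  fixes F :: "nat \<Rightarrow> nat \<Rightarrow> ereal"
  assumes fin: "\<And>i j. F i j < \<infinity>"
    and tri: "\<And>i j k. F i j + F j k \<le> F i k"
  shows "\<exists>g::nat \<Rightarrow> real. \<forall>i j. F i j \<le> ereal (g i - g j)"
proof -
  define P where "P = (\<lambda>(g::nat \<Rightarrow> real) n r.
    \<forall>i<n. F i n \<le> ereal (g i - r) \<and> F n i \<le> ereal (r - g i))"
  \<comment> \<open>A positive diagonal value would double under concatenation.\<close>
  have diag: "F i i \<le> 0" for i
    using tri[of i i i] fin[of i i] by (cases "F i i") auto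
  have "\<exists>g. \<forall>n. P g n (g n)"
  proof (rule dependent_wellorder_choice)
    fix r and f g :: "nat \<Rightarrow> real" and n :: nat
    assume "\<And>m. m < n \<Longrightarrow> f m = g m"
    then show "P f n r = P g n r" by (simp add: P_def)
  next
    fix n and g :: "nat \<Rightarrow> real"
    assume IH: "\<And>m. m < n \<Longrightarrow> P g m (g m)"
    have old: "F i j \<le> ereal (g i - g j)" if "i < n" "j < n" for i j
    proof (cases i j rule: linorder_cases)
      case less
      then show ?thesis using IH[OF that(2)] by (simp add: P_def)
    next
      case equal
      then show ?thesis using diag[of i] by (simp add: zero_ereal_def)
    next
      case greater
      then show ?thesis using IH[OF that(1)] by (simp add: P_def)
    qed
    have "\<exists>r::real. (\<forall>a\<in>(\<lambda>i. F n i + ereal (g i)) ` {..<n}. a \<le> ereal r) \<and>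
                    (\<forall>b\<in>(\<lambda>i. ereal (g i) - F i n) ` {..<n}. ereal r \<le> b)"
    proof (rule real_between_finite_ereal_sets)
      fix a assume "a \<in> (\<lambda>i. F n i + ereal (g i)) ` {..<n}"
      then show "a < \<infinity>" using fin by auto
    next
      fix b assume "b \<in> (\<lambda>i. ereal (g i) - F i n) ` {..<n}"
      then obtain i where "b = ereal (g i) - F i n" by blast
      then show "-\<infinity> < b" using fin[of i n] by (cases "F i n") auto
    next
      fix a b
      assume "a \<in> (\<lambda>i. F n i + ereal (g i)) ` {..<n}" "b \<in> (\<lambda>i. ereal (g i) - F i n) ` {..<n}"
      then obtain i j where ij: "i < n" "j < n"
        and a: "a = F n i + ereal (g i)" and b: "b = ereal (g j) - F j n" by blast
      have "F j n + F n i \<le> ereal (g j - g i)"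
        using tri[of j n i] old[OF ij(2,1)] by (rule order_trans)
      then show "a \<le> b"
        unfolding a b using fin[of j n] fin[of n i]
        by (cases "F j n"; cases "F n i") auto
    qed auto
    then obtain r where r: "\<And>i. i < n \<Longrightarrow> F n i + ereal (g i) \<le> ereal r"
        "\<And>i. i < n \<Longrightarrow> ereal r \<le> ereal (g i) - F i n"
      by auto
    have "P g n r"
      unfolding P_def
    proof (intro allI impI conjI)
      fix i assume i: "i < n"
      show "F i n \<le> ereal (g i - r)"
        using r(2)[OF i] fin[of i n] by (cases "F i n") auto
      show "F n i \<le> ereal (r - g i)"
        using r(1)[OF i] fin[of n i] by (cases "F n i") auto
    qed
    then show "\<exists>r. P g n r" ..
  qed
  then obtain g where g: "P g n (g n)" for n by blast
  have "F i j \<le> ereal (g i - g j)" for i j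
  proof (cases i j rule: linorder_cases)
    case less
    then show ?thesis using g[of j] by (simp add: P_def)
  next
    case equal
    then show ?thesis using diag[of i] by (simp add: zero_ereal_def)
  next
    case greater
    then show ?thesis using g[of i] by (simp add: P_def)
  qed
  then show ?thesis by blast
qed

lemma feasible_potential_countable:
  fixes F :: "'p \<Rightarrow> 'p \<Rightarrow> ereal"
  assumes E: "countable E"
    and fin: "\<And>s t. s \<in> E \<Longrightarrow> t \<in> E \<Longrightarrow> F s t < \<infinity>"
    and tri: "\<And>s r t. s \<in> E \<Longrightarrow> r \<in> E \<Longrightarrow> t \<in> E \<Longrightarrow> F s r + F r t \<le> F s t"
  shows "\<exists>g::'p \<Rightarrow> real. \<forall>s\<in>E. \<forall>t\<in>E. F s t \<le> ereal (g s - g t)"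
proof (cases "E = {}")
  case False
  let ?q = "from_nat_into E"
  have q: "?q n \<in> E" for n
    using False by (rule from_nat_into)
  obtain g where g: "\<And>i j. F (?q i) (?q j) \<le> ereal (g i - g j)"
    using feasible_potential_nat[of "\<lambda>i j. F (?q i) (?q j)"] fin tri q by blast
  have "F s t \<le> ereal (g (to_nat_on E s) - g (to_nat_on E t))" if "s \<in> E" "t \<in> E" for s t
    using g[of "to_nat_on E s" "to_nat_on E t"] E that by simp
  then show ?thesis
    by (intro exI[of _ "\<lambda>s. g (to_nat_on E s)"]) blast
qed simp

text \<open>
  The supremum \<open>h s\<close> of \<open>F s e + g e\<close> over \<open>e \<in> E\<close> satisfies \<open>F s t + h t \<le> h s\<close> by
  superadditivity. The link from \<open>s\<close> to some \<open>e \<in> E\<close> bounds it from below, and the link back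
  bounds it from above by \<open>g e - F e s\<close>.
\<close>

lemma feasible_potential_extend:
  fixes F :: "'p \<Rightarrow> 'p \<Rightarrow> ereal"
  assumes "E \<subseteq> G"
    and tri: "\<And>s r t. s \<in> G \<Longrightarrow> r \<in> G \<Longrightarrow> t \<in> G \<Longrightarrow> F s r + F r t \<le> F s t"
    and fin: "\<And>s t. s \<in> G \<Longrightarrow> t \<in> G \<Longrightarrow> F s t < \<infinity>"
    and link: "\<And>s. s \<in> G \<Longrightarrow> \<exists>e\<in>E. F s e > -\<infinity> \<and> F e s > -\<infinity>"
    and g: "\<And>s t. s \<in> E \<Longrightarrow> t \<in> E \<Longrightarrow> F s t \<le> ereal (g s - g t)"
  shows "\<exists>f::'p \<Rightarrow> real. \<forall>s\<in>G. \<forall>t\<in>G. F s t \<le> ereal (f s - f t)"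
proof -
  define h where "h s = (SUP e\<in>E. F s e + ereal (g e))" for s
  have real: "\<bar>h s\<bar> \<noteq> \<infinity>" if s: "s \<in> G" for s
  proof -
    obtain e where e: "e \<in> E" "F s e > -\<infinity>" "F e s > -\<infinity>"
      using link[OF s] by blast
    have eG: "e \<in> G" using e(1) \<open>E \<subseteq> G\<close> by blast
    have "F s e + ereal (g e) \<le> h s"
      unfolding h_def using e(1) by (rule SUP_upper)
    then have lower: "h s \<noteq> -\<infinity>"
      using e(2) by (cases "F s e") auto
    have "h s \<le> ereal (g e) - F e s"
      unfolding h_def
    proof (rule SUP_least)
      fix d assume d: "d \<in> E"
      then have dG: "d \<in> G" using \<open>E \<subseteq> G\<close> by blast
      have "F e s + F s d \<le> ereal (g e - g d)"
        using tri[OF eG s dG] g[OF e(1) d] by (rule order_trans)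
      then show "F s d + ereal (g d) \<le> ereal (g e) - F e s"
        using fin[OF eG s] fin[OF s dG] e(3)
        by (cases "F e s"; cases "F s d") auto
    qed
    then have "h s \<noteq> \<infinity>"
      using e(3) fin[OF eG s] by (cases "F e s") auto
    with lower show ?thesis by auto
  qed
  have "F s t \<le> ereal (real_of_ereal (h s) - real_of_ereal (h t))" if st: "s \<in> G" "t \<in> G" for s t
  proof (cases "F s t = -\<infinity>")
    case False
    then obtain a where a: "F s t = ereal a"
      using fin[OF st] by (cases "F s t") auto
    have "h t \<le> h s - F s t"
      unfolding h_def[of t]
    proof (rule SUP_least)
      fix e assume e: "e \<in> E"
      then have eG: "e \<in> G" using \<open>E \<subseteq> G\<close> by blast
      have "F s t + (F t e + ereal (g e)) \<le> F s e + ereal (g e)"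
        using add_right_mono[OF tri[OF st eG]] by (simp add: add.assoc)
      also have "\<dots> \<le> h s"
        unfolding h_def using e by (rule SUP_upper)
      finally show "F t e + ereal (g e) \<le> h s - F s t"
        by (simp add: a ereal_le_minus add.commute)
    qed
    then show ?thesis
      using real[OF st(1)] real[OF st(2)] a by (cases "h s"; cases "h t") auto
  qed simp
  then show ?thesis
    by (intro exI[of _ "\<lambda>s. real_of_ereal (h s)"]) blast
qed

section \<open>Inner variation along paths\<close>

lemma path_sum_le_max_inner_variation:
  assumes "c_path c G s e N p"
  shows "(\<Sum>k=1..N. c (p k) - c (fst (p (k + 1)), snd (p k))) \<le> max_inner_variation c G s e"
  unfolding max_inner_variation_def
  by (intro Sup_upper CollectI exI[of _ N] exI[of _ p] conjI refl assms)

lemma single_step_le_max_inner_variation: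
  assumes "s \<in> G" "e \<in> G" "c (fst e, snd s) < \<infinity>"
  shows "c s - c (fst e, snd s) \<le> max_inner_variation c G s e"
proof -
  let ?p = "\<lambda>k::nat. if k = 1 then s else e"
  have "c_path c G s e 1 ?p"
    using assms by (simp add: c_path_def)
  from path_sum_le_max_inner_variation[OF this] show ?thesis by simp
qed

text \<open>
  The last point of the first path is the first point of the second one, so the two index
  conventions for \<open>w\<close> agree at \<open>N + 1\<close>.
\<close>

lemma c_path_concat:
  assumes p: "c_path c G s r N p" and q: "c_path c G r t M q"
  defines "w \<equiv> \<lambda>k. if k \<le> N then p k else q (k - N)"
  shows "c_path c G s t (N + M) w"
    and "(\<Sum>k=1..N+M. c (w k) - c (fst (w (k + 1)), snd (w k))) =
         (\<Sum>k=1..N. c (p k) - c (fst (p (k + 1)), snd (p k))) +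
         (\<Sum>k=1..M. c (q k) - c (fst (q (k + 1)), snd (q k)))"
proof -
  have w1: "w k = p k" if "k \<le> N + 1" for k
  proof (cases "k \<le> N")
    case False
    then have "k = N + 1" using that by simp
    then show ?thesis using p q by (simp add: w_def c_path_def)
  qed (simp add: w_def)
  have w2: "w (k + N) = q k" if "1 \<le> k" for k
    using that by (simp add: w_def)
  have w2': "w k = q (k - N)" if "N < k" for k
    using that by (simp add: w_def)
  show "c_path c G s t (N + M) w"
    unfolding c_path_def
  proof (intro conjI ballI)
    show "1 \<le> N + M" using p by (simp add: c_path_def)
    show "w 1 = s" using p w1[of 1] by (simp add: c_path_def)
    show "w (N + M + 1) = t" using q w2[of "M + 1"] by (simp add: c_path_def add.commute)
  next
    fix k assume k: "k \<in> {1..N + M + 1}"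
    show "w k \<in> G"
    proof (cases "k \<le> N + 1")
      case True
      then show ?thesis using p k w1[of k] by (auto simp: c_path_def)
    next
      case False
      then have "k - N \<in> {1..M + 1}" using k by auto
      then show ?thesis using q False w2'[of k] by (auto simp: c_path_def)
    qed
  next
    fix k assume k: "k \<in> {1..N + M}"
    show "c (fst (w (k + 1)), snd (w k)) < \<infinity>"
    proof (cases "k \<le> N")
      case True
      then show ?thesis using p k w1[of k] w1[of "k + 1"] by (auto simp: c_path_def)
    next
      case False
      then have "k - N \<in> {1..M}" using k by auto
      moreover have "k + 1 - N = (k - N) + 1" using False by auto
      ultimately show ?thesis
        using q False w2'[of k] w2'[of "k + 1"] by (auto simp: c_path_def)
    qed
  qed
  let ?i = "\<lambda>w k. c (w k) - c (fst (w (k + 1)), snd (w k))"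
  have "(\<Sum>k=1..N+M. ?i w k) = (\<Sum>k=1..N. ?i w k) + (\<Sum>k=1+N..M+N. ?i w k)"
    using sum.ub_add_nat[of 1 N "?i w" M] by (simp add: add.commute)
  also have "(\<Sum>k=1..N. ?i w k) = (\<Sum>k=1..N. ?i p k)"
    by (intro sum.cong refl) (simp add: w1)
  also have "(\<Sum>k=1+N..M+N. ?i w k) = (\<Sum>k=1..M. ?i w (k + N))"
    by (rule sum.shift_bounds_cl_nat_ivl)
  also have "\<dots> = (\<Sum>k=1..M. ?i q k)"
  proof (intro sum.cong refl)
    fix k assume "k \<in> {1..M}"
    then show "?i w (k + N) = ?i q k"
      using w2[of k] w2[of "k + 1"] by (simp add: add.commute add.left_commute)
  qed
  finally show "(\<Sum>k=1..N+M. ?i w k) = (\<Sum>k=1..N. ?i p k) + (\<Sum>k=1..M. ?i q k)" .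
qed

lemma max_inner_variation_superadditive:
  assumes "max_inner_variation c G s r < \<infinity>" "max_inner_variation c G r t < \<infinity>"
  shows "max_inner_variation c G s r + max_inner_variation c G r t \<le> max_inner_variation c G s t"
  unfolding max_inner_variation_def[of c G s r] max_inner_variation_def[of c G r t]
proof (rule ereal_Sup_add_le)
  fix a b
  assume "a \<in> {\<Sum>k=1..N. c (p k) - c (fst (p (k + 1)), snd (p k)) | N p. c_path c G s r N p}"
    and "b \<in> {\<Sum>k=1..N. c (p k) - c (fst (p (k + 1)), snd (p k)) | N p. c_path c G r t N p}"
  then obtain N p M q where p: "c_path c G s r N p" and q: "c_path c G r t M q"
    and a: "a = (\<Sum>k=1..N. c (p k) - c (fst (p (k + 1)), snd (p k)))"
    and b: "b = (\<Sum>k=1..M. c (q k) - c (fst (q (k + 1)), snd (q k)))"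
    by blast
  show "a + b \<le> max_inner_variation c G s t"
    unfolding a b c_path_concat(2)[OF p q, symmetric]
    by (rule path_sum_le_max_inner_variation[OF c_path_concat(1)[OF p q]])
qed (use assms in \<open>simp_all add: max_inner_variation_def\<close>)

text \<open>
  The increments of \<open>f\<close> dominate the summands along a path, and they telescope.
\<close>

lemma max_inner_variation_le_antiderivative:
  assumes f: "c_antiderivative c G f"
  shows "max_inner_variation c G s e \<le> ereal (f s - f e)"
  unfolding max_inner_variation_def
proof (rule Sup_least)
  have tele: "(\<Sum>k=1..N. c (p k) - c (fst (p (k + 1)), snd (p k))) \<le> ereal (f (p 1) - f (p (N + 1)))"
    if "\<forall>k\<in>{1..N + 1}. p k \<in> G" for N and p :: "nat \<Rightarrow> 'a \<times> 'b"
    using that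
  proof (induction N)
    case (Suc N)
    have step: "c (p (Suc N)) - c (fst (p (Suc N + 1)), snd (p (Suc N)))
        \<le> ereal (f (p (Suc N)) - f (p (Suc N + 1)))"
      using f Suc.prems unfolding c_antiderivative_def
      by (metis atLeastAtMost_iff le_add1 le_add2 order_refl plus_1_eq_Suc prod.collapse)
    have "(\<Sum>k=1..N. c (p k) - c (fst (p (k + 1)), snd (p k))) \<le> ereal (f (p 1) - f (p (N + 1)))"
      using Suc by simp
    from add_mono[OF this step] show ?case by simp
  qed (simp add: zero_ereal_def)
  fix x assume "x \<in> {\<Sum>k=1..N. c (p k) - c (fst (p (k + 1)), snd (p k)) | N p. c_path c G s e N p}"
  then obtain N p where "c_path c G s e N p"
    "x = (\<Sum>k=1..N. c (p k) - c (fst (p (k + 1)), snd (p k)))" by blast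
  then show "x \<le> ereal (f s - f e)"
    using tele[of N p] by (auto simp: c_path_def)
qed

section \<open>Antiderivatives from path boundedness\<close>

text \<open>
  A countable dense set of the whole space may miss \<open>S\<close> altogether. One point of \<open>S\<close> is
  therefore picked near each of its points \<open>a\<close> and for each precision \<open>1 / (n + 1)\<close> at which
  there is one.
\<close>

lemma countable_dense_in_subset:
  fixes S :: "'a::metric_space set"
  assumes "separable_space (euclidean :: 'a topology)"
  obtains E where "countable E" "E \<subseteq> S" "\<And>s \<epsilon>. s \<in> S \<Longrightarrow> 0 < \<epsilon> \<Longrightarrow> \<exists>e\<in>E. dist s e < \<epsilon>"
proof -
  obtain C :: "'a set" where C: "countable C" "closure C = UNIV"
    using assms by (auto simp: separable_space_def)
  define pick where "pick = (\<lambda>(a, n::nat). SOME s. s \<in> S \<and> dist a s < inverse (Suc n))"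
  define I where "I = {(a, n). a \<in> C \<and> (\<exists>s. s \<in> S \<and> dist a s < inverse (real (Suc n)))}"
  have pick: "pick (a, n) \<in> S \<and> dist a (pick (a, n)) < inverse (Suc n)" if "(a, n) \<in> I" for a n
  proof -
    have "\<exists>s. s \<in> S \<and> dist a s < inverse (real (Suc n))" using that by (simp add: I_def)
    then show ?thesis unfolding pick_def by (simp only: prod.case) (rule someI_ex)
  qed
  show ?thesis
  proof
    have "I \<subseteq> C \<times> UNIV" by (auto simp: I_def)
    then show "countable (pick ` I)"
      using C(1) countable_subset[of I "C \<times> UNIV"] by blast
    show "pick ` I \<subseteq> S" using pick by auto
    fix s and \<epsilon> :: real assume s: "s \<in> S" and "0 < \<epsilon>"
    then obtain n where n: "inverse (real (Suc n)) < \<epsilon> / 2"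
      using reals_Archimedean[of "\<epsilon> / 2"] by auto
    obtain a where a: "a \<in> C" "dist a s < inverse (real (Suc n))"
      using closure_approachable[of s C] C(2)
      by (metis UNIV_I inverse_positive_iff_positive of_nat_0_less_iff zero_less_Suc)
    then have "(a, n) \<in> I" using s by (auto simp: I_def)
    moreover have "dist s (pick (a, n)) < \<epsilon>"
      using pick[OF calculation] a(2) n dist_triangle[of s "pick (a, n)" a] by (simp add: dist_commute)
    ultimately show "\<exists>e\<in>pick ` I. dist s e < \<epsilon>" by blast
  qed
qed

lemma separable_space_euclidean_prod:
  assumes "separable_space (euclidean :: 'a::topological_space topology)"
    and "separable_space (euclidean :: 'b::topological_space topology)"
  shows "separable_space (euclidean :: ('a \<times> 'b) topology)"
proof -
  obtain A :: "'a set" and B :: "'b set"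
    where "countable A" "closure A = UNIV" "countable B" "closure B = UNIV"
    using assms by (auto simp: separable_space_def)
  then have "countable (A \<times> B)" "closure (A \<times> B) = UNIV"
    by (simp_all add: closure_Times)
  then show ?thesis by (auto simp: separable_space_def)
qed

text \<open>
  With \<open>D\<close> the domain of the cost, this joins nearby points of \<open>G\<close> by one-step paths in both
  directions. It yields the links to a countable dense subset as well as the continuity of
  antiderivatives.
\<close>

lemma nearby_points_cross_in_open:
  fixes D :: "('a::metric_space \<times> 'b::metric_space) set"
  assumes "open D" "s \<in> D"
  obtains \<epsilon> where "0 < \<epsilon>"
    "\<And>t. dist s t < \<epsilon> \<Longrightarrow> (fst t, snd s) \<in> D \<and> (fst s, snd t) \<in> D"
proof -
  obtain \<epsilon> where \<epsilon>: "0 < \<epsilon>" "\<And>t. dist t s < \<epsilon> \<Longrightarrow> t \<in> D"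
    using assms unfolding open_dist by blast
  show ?thesis
  proof
    fix t assume t: "dist s t < \<epsilon>"
    have "dist (fst t, snd s) s \<le> dist s t" "dist (fst s, snd t) s \<le> dist s t"
      by (simp_all add: dist_prod_def dist_commute)
    with t \<epsilon>(2) show "(fst t, snd s) \<in> D \<and> (fst s, snd t) \<in> D" by fastforce
  qed (rule \<epsilon>(1))
qed

lemma antiderivative_exists_if_path_bounded:
  fixes c :: "'a::metric_space \<times> 'b::metric_space \<Rightarrow> ereal"
  assumes sep: "separable_space (euclidean :: ('a \<times> 'b) topology)"
    and nm: "\<And>p. c p \<noteq> -\<infinity>"
    and op: "open (cost_dom c)"
    and GD: "G \<subseteq> cost_dom c"
    and bd: "c_path_bounded c G"
  shows "\<exists>f. c_antiderivative c G f"
proof -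
  let ?F = "max_inner_variation c G"
  have fin: "?F s t < \<infinity>" if "s \<in> G" "t \<in> G" for s t
    using bd that by (simp add: c_path_bounded_def)
  have step: "c s - c (fst t, snd s) \<le> ?F s t" if "s \<in> G" "t \<in> G" for s t
  proof (cases "c (fst t, snd s) < \<infinity>")
    case False
    then show ?thesis using that GD nm[of s] by (cases "c s") (auto simp: cost_dom_def)
  qed (use that in \<open>rule single_step_le_max_inner_variation\<close>)
  have tri: "?F s r + ?F r t \<le> ?F s t" if "s \<in> G" "r \<in> G" "t \<in> G" for s r t
    using that fin by (intro max_inner_variation_superadditive)
  obtain E where E: "countable E" "E \<subseteq> G"
    and dense: "\<And>s \<epsilon>. s \<in> G \<Longrightarrow> 0 < \<epsilon> \<Longrightarrow> \<exists>e\<in>E. dist s e < \<epsilon>"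
    using countable_dense_in_subset[OF sep] by metis
  have EG: "e \<in> G" if "e \<in> E" for e
    using that E(2) by blast
  have link: "\<exists>e\<in>E. ?F s e > -\<infinity> \<and> ?F e s > -\<infinity>" if s: "s \<in> G" for s
  proof -
    have sD: "s \<in> cost_dom c" using s GD by blast
    obtain \<epsilon> where \<epsilon>: "0 < \<epsilon>"
      "\<And>t. dist s t < \<epsilon> \<Longrightarrow> (fst t, snd s) \<in> cost_dom c \<and> (fst s, snd t) \<in> cost_dom c"
      using nearby_points_cross_in_open[OF op sD] by metis
    obtain e where e: "e \<in> E" "dist s e < \<epsilon>" using dense[OF s \<epsilon>(1)] by blast
    have pos: "-\<infinity> < ?F a b" if "a \<in> G" "b \<in> G" "(fst b, snd a) \<in> cost_dom c" for a b
    proof -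
      have "-\<infinity> < c a - c (fst b, snd a)"
        using that(3) nm[of a] nm[of "(fst b, snd a)"]
        by (cases "c a"; cases "c (fst b, snd a)") (auto simp: cost_dom_def)
      with step[OF that(1,2)] show ?thesis by (rule less_le_trans[rotated])
    qed
    show ?thesis
      using pos[OF s EG[OF e(1)]] pos[OF EG[OF e(1)] s] \<epsilon>(2)[OF e(2)] e(1) by blast
  qed
  have "\<exists>g::'a \<times> 'b \<Rightarrow> real. \<forall>s\<in>E. \<forall>t\<in>E. ?F s t \<le> ereal (g s - g t)"
    by (rule feasible_potential_countable) (use E fin tri EG in auto)
  then obtain g :: "'a \<times> 'b \<Rightarrow> real"
    where g: "\<And>s t. s \<in> E \<Longrightarrow> t \<in> E \<Longrightarrow> ?F s t \<le> ereal (g s - g t)" by blast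
  have "\<exists>f::'a \<times> 'b \<Rightarrow> real. \<forall>s\<in>G. \<forall>t\<in>G. ?F s t \<le> ereal (f s - f t)"
    by (rule feasible_potential_extend[OF E(2) tri fin link g])
  then obtain f :: "'a \<times> 'b \<Rightarrow> real"
    where f: "\<And>s t. s \<in> G \<Longrightarrow> t \<in> G \<Longrightarrow> ?F s t \<le> ereal (f s - f t)" by blast
  have "c_antiderivative c G f"
    unfolding c_antiderivative_def
  proof (intro allI impI)
    fix x y u v assume "(x, y) \<in> G" "(u, v) \<in> G"
    from order_trans[OF step[OF this] f[OF this]]
    show "c (x, y) - c (u, y) \<le> ereal (f (x, y) - f (u, v))" by simp
  qed
  then show ?thesis by blast
qed

text \<open>
  For \<open>t\<close> near \<open>s\<close>, the antiderivative inequality for \<open>(s, t)\<close> bounds \<open>f t\<close> from above and the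
  one for \<open>(t, s)\<close> from below. Both bounds involve the cost only at \<open>s\<close>, at \<open>t\<close> and at the
  crossed pairs, all of which tend to \<open>s\<close> inside the open domain.
\<close>

lemma antiderivative_continuous:
  fixes c :: "'a::metric_space \<times> 'b::metric_space \<Rightarrow> ereal"
  assumes nm: "\<And>p. c p \<noteq> -\<infinity>"
    and op: "open (cost_dom c)"
    and cont: "continuous_on (cost_dom c) c"
    and GD: "G \<subseteq> cost_dom c"
    and f: "c_antiderivative c G f"
  shows "continuous_on G f"
  unfolding continuous_on_def
proof
  fix s assume s: "s \<in> G"
  then have sD: "s \<in> cost_dom c" using GD by blast
  define C where "C p = real_of_ereal (c p)" for p
  have C: "c p = ereal (C p)" if "p \<in> cost_dom c" for p
    using that nm[of p] by (cases "c p") (auto simp: C_def cost_dom_def)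
  have contC: "isCont C p" if "p \<in> cost_dom c" for p
  proof -
    have "continuous_on (cost_dom c) (\<lambda>p. ereal (C p))"
      using cont by (subst continuous_on_cong[OF refl, of _ _ c]) (simp_all add: C)
    then have "continuous_on (cost_dom c) C"
      using continuous_on_iff_real[of "cost_dom c" "\<lambda>p. ereal (C p)"] by (simp add: o_def)
    then show ?thesis using op that by (simp add: continuous_on_eq_continuous_at)
  qed
  obtain \<epsilon> where \<epsilon>: "0 < \<epsilon>"
    "\<And>t. dist s t < \<epsilon> \<Longrightarrow> (fst t, snd s) \<in> cost_dom c \<and> (fst s, snd t) \<in> cost_dom c"
    using nearby_points_cross_in_open[OF op sD] by metis
  have sand: "f s - (C s - C (fst t, snd s)) \<ge> f t \<and> f t \<ge> f s + (C t - C (fst s, snd t))"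
    if t: "t \<in> G" "dist s t < \<epsilon>" for t
  proof -
    have "c s - c (fst t, snd s) \<le> ereal (f s - f t)" "c t - c (fst s, snd t) \<le> ereal (f t - f s)"
      using f s t(1) unfolding c_antiderivative_def by (metis prod.collapse)+
    moreover have "t \<in> cost_dom c" using t(1) GD by blast
    ultimately show ?thesis
      using \<epsilon>(2)[OF t(2)] sD by (simp add: C)
  qed
  have ev: "\<forall>\<^sub>F t in at s within G. t \<in> G \<and> dist s t < \<epsilon>"
    using \<epsilon>(1) by (auto simp: eventually_at dist_commute)
  have lim: "((\<lambda>t. C (h t)) \<longlongrightarrow> C s) (at s within G)"
    if "(h \<longlongrightarrow> s) (at s within G)" for h
    using isCont_tendsto_compose[OF contC[OF sD] that] .
  have fst: "((\<lambda>t. (fst t, snd s)) \<longlongrightarrow> s) (at s within G)"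
    using tendsto_Pair[OF tendsto_fst[OF tendsto_ident_at[of s G]] tendsto_const[of "snd s" "at s within G"]] by simp
  have snd: "((\<lambda>t. (fst s, snd t)) \<longlongrightarrow> s) (at s within G)"
    using tendsto_Pair[OF tendsto_const[of "fst s" "at s within G"] tendsto_snd[OF tendsto_ident_at[of s G]]] by simp
  show "(f \<longlongrightarrow> f s) (at s within G)"
  proof (rule tendsto_sandwich)
    show "\<forall>\<^sub>F t in at s within G. f s + (C t - C (fst s, snd t)) \<le> f t"
      using ev by eventually_elim (use sand in blast)
    show "\<forall>\<^sub>F t in at s within G. f t \<le> f s - (C s - C (fst t, snd s))"
      using ev by eventually_elim (use sand in blast)
    show "((\<lambda>t. f s + (C t - C (fst s, snd t))) \<longlongrightarrow> f s) (at s within G)"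
      using tendsto_add[OF tendsto_const tendsto_diff[OF lim[OF tendsto_ident_at] lim[OF snd]], of "f s"]
      by simp
    show "((\<lambda>t. f s - (C s - C (fst t, snd s))) \<longlongrightarrow> f s) (at s within G)"
      using tendsto_diff[OF tendsto_const tendsto_diff[OF tendsto_const lim[OF fst]], of "f s" "C s"]
      by simp
  qed
qed

section \<open>Potentials and antiderivatives\<close>

text \<open>
  A strict sublevel set of an infimum is the union of the strict sublevel sets of its members,
  and each member \<open>c (\<cdot>, y) - \<phi> y\<close> is continuous on the open slice of the domain at \<open>y\<close>.
\<close>

lemma c_class_upper_semicontinuous:
  fixes c :: "'a::metric_space \<times> 'b::metric_space \<Rightarrow> ereal"
  assumes nm: "\<And>p. c p \<noteq> -\<infinity>"
    and op: "open (cost_dom c)"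
    and cont: "continuous_on (cost_dom c) c"
    and "c_class c \<psi>"
  shows "upper_semicontinuous \<psi>"
  unfolding upper_semicontinuous_def
proof
  fix a :: ereal
  obtain \<phi> where \<psi>: "\<psi> = cbar_conj c \<phi>"
    using \<open>c_class c \<psi>\<close> by (auto simp: c_class_def)
  have "open {p \<in> cost_dom c. c p - k < a}" for k
  proof (cases "\<bar>k\<bar> = \<infinity>")
    case False
    then have "{p \<in> cost_dom c. c p - k < a} = cost_dom c \<inter> c -` {..<a + k}"
      by (auto simp: ereal_minus_less)
    then show ?thesis
      using continuous_open_preimage[OF cont op, of "{..<a + k}"] by simp
  next
    case True
    \<comment> \<open>On the domain the cost is finite, so an infinite \<open>k\<close> makes the difference constant.\<close>
    have "c p - k = - k" if "p \<in> cost_dom c" for p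
      using that nm[of p] True by (cases "c p"; cases k) (auto simp: cost_dom_def)
    then have "{p \<in> cost_dom c. c p - k < a} = (if - k < a then cost_dom c else {})" by auto
    then show ?thesis using op by simp
  qed
  then have "open ((\<lambda>x. (x, y)) -` {p \<in> cost_dom c. c p - \<phi> y < a})" for y
    by (intro open_vimage continuous_intros)
  moreover have "{x. \<psi> x < a} = (\<Union>y. (\<lambda>x. (x, y)) -` {p \<in> cost_dom c. c p - \<phi> y < a})"
    unfolding \<psi> cbar_conj_def Inf_less_iff by blast
  ultimately show "open {x. \<psi> x < a}" by auto
qed

text \<open>
  The conjugate \<open>c_conj c \<psi> y\<close> equals \<open>c (x, y) - \<psi> x\<close> at a point of the graph and is at most
  \<open>c (u, y) - \<psi> u\<close> for every competitor \<open>u\<close> in the slice.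
\<close>

lemma potential_imp_antiderivative:
  assumes nm: "\<And>p. c p \<noteq> -\<infinity>"
    and \<psi>: "c_potential c G \<psi>"
  shows "c_antiderivative c G (\<lambda>(x, y). real_of_ereal (\<psi> x))"
  unfolding c_antiderivative_def
proof (intro allI impI)
  fix x y u v assume G: "(x, y) \<in> G" "(u, v) \<in> G"
  have gr: "\<bar>\<psi> x\<bar> \<noteq> \<infinity>" "\<psi> x + c_conj c \<psi> y = c (x, y)" "c (x, y) < \<infinity>" "\<bar>\<psi> u\<bar> \<noteq> \<infinity>"
    using \<psi> G by (auto simp: c_potential_def c_subdiff_graph_def c_subdiff_def)
  show "c (x, y) - c (u, y) \<le> ereal ((case (x, y) of (x, y) \<Rightarrow> real_of_ereal (\<psi> x)) -
      (case (u, v) of (x, y) \<Rightarrow> real_of_ereal (\<psi> x)))"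
  proof (cases "c (u, y) < \<infinity>")
    case True
    then have "c_conj c \<psi> y \<le> c (u, y) - \<psi> u"
      unfolding c_conj_def by (intro Inf_lower) (auto simp: cost_dom_def)
    then show ?thesis
      using gr True nm[of "(u, y)"] nm[of "(x, y)"]
      by (cases "\<psi> x"; cases "\<psi> u"; cases "c (u, y)"; cases "c (x, y)"; cases "c_conj c \<psi> y") auto
  next
    case False
    then show ?thesis using gr(3) nm[of "(x, y)"] by (cases "c (x, y)") auto
  qed
qed

text \<open>
  The antiderivative inequality for two points of \<open>G\<close> with the same second coordinate, taken
  both ways, shows that \<open>c - f\<close> depends only on that coordinate. This function of \<open>y\<close>,
  with value \<open>-\<infinity>\<close> off the projection of \<open>G\<close>, is \<open>\<phi>\<close>; its conjugate is the potential.
\<close>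

lemma antiderivative_imp_potential:
  fixes c :: "'a \<times> 'b \<Rightarrow> ereal"
  assumes nm: "\<And>p. c p \<noteq> -\<infinity>"
    and GD: "G \<subseteq> cost_dom c"
    and f: "c_antiderivative c G f"
  shows "\<exists>\<psi>. c_potential c G \<psi>"
proof -
  have anti: "c (x, y) - c (u, y) \<le> ereal (f (x, y) - f (u, v))" if "(x, y) \<in> G" "(u, v) \<in> G" for x y u v
    using f that by (simp add: c_antiderivative_def)
  have real: "\<exists>r. c p = ereal r" if "p \<in> cost_dom c" for p
    using that nm[of p] by (cases "c p") (auto simp: cost_dom_def)
  \<comment> \<open>The supremum runs over equal values; it supplies \<open>-\<infinity>\<close> when there are none.\<close>
  define \<phi> where "\<phi> y = (SUP p\<in>{p \<in> G. snd p = y}. c p - ereal (f p))" for y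
  define \<psi> where "\<psi> = cbar_conj c \<phi>"
  have \<phi>: "\<phi> y = c (x, y) - ereal (f (x, y))" if xy: "(x, y) \<in> G" for x y
  proof (rule antisym)
    show "\<phi> y \<le> c (x, y) - ereal (f (x, y))"
      unfolding \<phi>_def
    proof (rule SUP_least)
      fix p assume "p \<in> {p \<in> G. snd p = y}"
      then obtain u where p: "p = (u, y)" "(u, y) \<in> G" by (cases p) auto
      then show "c p - ereal (f p) \<le> c (x, y) - ereal (f (x, y))"
        using anti[OF p(2) xy] real[OF subsetD[OF GD xy]] real[OF subsetD[OF GD p(2)]] by auto
    qed
    show "c (x, y) - ereal (f (x, y)) \<le> \<phi> y"
      unfolding \<phi>_def by (rule SUP_upper) (use xy in simp)
  qed
  have \<psi>_le: "\<psi> x \<le> c (x, y) - \<phi> y" if "(x, y) \<in> cost_dom c" for x y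
    unfolding \<psi>_def cbar_conj_def by (rule Inf_lower) (use that in blast)
  have \<psi>_eq: "\<psi> x = ereal (f (x, y))" if xy: "(x, y) \<in> G" for x y
  proof (rule antisym)
    have D: "(x, y) \<in> cost_dom c" using xy GD by blast
    show "\<psi> x \<le> ereal (f (x, y))"
      using \<psi>_le[OF D] \<phi>[OF xy] real[OF D] by auto
    show "ereal (f (x, y)) \<le> \<psi> x"
      unfolding \<psi>_def cbar_conj_def
    proof (rule Inf_greatest)
      fix a assume "a \<in> {c (x, v) - \<phi> v | v. (x, v) \<in> cost_dom c}"
      then obtain v where a: "a = c (x, v) - \<phi> v" and xv: "(x, v) \<in> cost_dom c" by blast
      show "ereal (f (x, y)) \<le> a"
      proof (cases "\<exists>u. (u, v) \<in> G")
        case True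
        then obtain u where uv: "(u, v) \<in> G" ..
        then have uD: "(u, v) \<in> cost_dom c" using GD by blast
        show ?thesis
          using anti[OF uv xy] real[OF xv] real[OF uD] by (auto simp: a \<phi>[OF uv])
      next
        case False
        then have "{p \<in> G. snd p = v} = {}" by auto
        then have "\<phi> v = -\<infinity>" by (simp only: \<phi>_def image_empty Sup_empty bot_ereal_def)
        then show ?thesis using real[OF xv] by (auto simp: a)
      qed
    qed
  qed
  have "(x, y) \<in> c_subdiff_graph c \<psi>" if xy: "(x, y) \<in> G" for x y
  proof -
    have D: "(x, y) \<in> cost_dom c" using xy GD by blast
    have "c_conj c \<psi> y = c (x, y) - \<psi> x"
    proof (rule antisym)
      show "c_conj c \<psi> y \<le> c (x, y) - \<psi> x"
        unfolding c_conj_def by (rule Inf_lower) (use D in blast)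
      show "c (x, y) - \<psi> x \<le> c_conj c \<psi> y"
        unfolding c_conj_def
      proof (rule Inf_greatest)
        fix a assume "a \<in> {c (u, y) - \<psi> u | u. (u, y) \<in> cost_dom c}"
        then obtain u where a: "a = c (u, y) - \<psi> u" and uy: "(u, y) \<in> cost_dom c" by blast
        show "c (x, y) - \<psi> x \<le> a"
          using \<psi>_le[OF uy] real[OF uy] real[OF D]
          by (cases "\<psi> u") (auto simp: a \<phi>[OF xy] \<psi>_eq[OF xy])
      qed
    qed
    then show ?thesis
      using real[OF D] \<psi>_eq[OF xy] by (auto simp: c_subdiff_graph_def c_subdiff_def)
  qed
  then have "c_potential c G \<psi>"
    by (auto simp: c_potential_def c_class_def \<psi>_def)
  then show ?thesis by blast
qed

section \<open>The equivalence\<close>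

theorem theorem4p11:
  fixes c :: "'a::metric_space \<times> 'b::metric_space \<Rightarrow> ereal"
    and G :: "('a \<times> 'b) set"
  assumes "separable_space (euclidean :: 'a topology)"
    and "separable_space (euclidean :: 'b topology)"
    and "\<And>p. c p \<noteq> -\<infinity>"
    and "cost_dom c \<noteq> {}"
    and "open (cost_dom c)"
    and "continuous_on (cost_dom c) c"
    and "G \<noteq> {}"
    and "G \<subseteq> cost_dom c"
  shows "((\<exists>\<psi>. c_potential c G \<psi> \<and> upper_semicontinuous \<psi>) \<longleftrightarrow>
          (\<exists>f. c_antiderivative c G f \<and> continuous_on G f)) \<and>
         ((\<exists>f. c_antiderivative c G f \<and> continuous_on G f) \<longleftrightarrow>
          c_path_bounded c G)"
proof -
  have cont: "continuous_on G f" if "c_antiderivative c G f" for f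
    using antiderivative_continuous[OF assms(3,5,6,8) that] .
  have usc: "upper_semicontinuous \<psi>" if "c_potential c G \<psi>" for \<psi>
    using c_class_upper_semicontinuous[OF assms(3,5,6)] that by (auto simp: c_potential_def)
  have sep: "separable_space (euclidean :: ('a \<times> 'b) topology)"
    using assms(1,2) by (rule separable_space_euclidean_prod)
  have "(\<exists>\<psi>. c_potential c G \<psi>) \<longleftrightarrow> (\<exists>f. c_antiderivative c G f)"
    using potential_imp_antiderivative[where c = c, OF assms(3)] antiderivative_imp_potential[OF assms(3,8)]
    by blast
  moreover have "(\<exists>f. c_antiderivative c G f) \<longleftrightarrow> c_path_bounded c G"
  proof
    assume "\<exists>f. c_antiderivative c G f"
    then obtain f where "c_antiderivative c G f" ..
    then have "max_inner_variation c G s e < \<infinity>" for s e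
      using max_inner_variation_le_antiderivative[of c G f s e] by (auto intro: le_less_trans)
    then show "c_path_bounded c G" by (simp add: c_path_bounded_def)
  qed (rule antiderivative_exists_if_path_bounded[OF sep assms(3,5,8)])
  ultimately show ?thesis
    using cont usc by blast
qed

end
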